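(* For every constant $k$ there exists a graph $G$ with $$\chi(G)-r(G)>k .$$
   Context: All graphs are finite, simple, undirected and loopless. $\chi(G)$ is the chromatic number of $G$. A path in $G$ is a (not necessarily induced) subgraph of $G$ that is a path. For a graph $G$, $r(G)$ denotes the maximum of $\chi(G[V(P)])$ over all paths $P$ in $G$, where $G[V(P)]$ is the subgraph of $G$ induced by the vertex set of $P$. *)

theory Defs
  imports Complex_Main "Graph_Theory.Graph_Theory"
begin

text \<open>
  A finite simple undirected graph is a digraph satisfying the locale predicate
  \<^const>\<open>graph\<close>: finite, loop-free, without parallel arcs and symmetric, an edge
  $uv$ being the pair of arcs $(u,v)$, $(v,u)$.
\<close>

definition proper_colouring :: "('a, 'b) pre_digraph \<Rightarrow> ('a \<Rightarrow> nat) \<Rightarrow> bool" where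
  "proper_colouring G c \<longleftrightarrow> (\<forall>(u, v) \<in> arcs_ends G. c u \<noteq> c v)"

definition colourable :: "('a, 'b) pre_digraph \<Rightarrow> nat \<Rightarrow> bool" where
  "colourable G n \<longleftrightarrow> (\<exists>c. proper_colouring G c \<and> c ` verts G \<subseteq> {..<n})"

definition chromatic_number :: "('a, 'b) pre_digraph \<Rightarrow> nat" where
  "chromatic_number G = (LEAST n. colourable G n)"

text \<open>
  The parameter $r(G)$. A \<^const>\<open>vpath\<close> is a nonempty list of distinct vertices, consecutive
  ones being adjacent in \<open>G\<close>; \<open>G \<restriction> set p\<close> is the subgraph of \<open>G\<close> induced by
  its vertex set. The null graph has no path, so the maximum is meaningful for graphs with at
  least one vertex; since the null graph has chromatic number 0, whatever value the
  maximum takes there, it never yields a positive difference $\chi(G) - r(G)$.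
\<close>
definition path_chromatic_number :: "('a, 'b) pre_digraph \<Rightarrow> nat" where
  "path_chromatic_number G = Max {chromatic_number (G \<restriction> set p) | p. vpath p G}"

lemma colourable_chromatic_number:
  assumes "graph G"
  shows "colourable G (chromatic_number G)"
proof -
  interpret graph G by fact
  obtain f :: "'a \<Rightarrow> nat" and n where f: "f ` verts G = {i. i < n}" "inj_on f (verts G)"
    using finite_imp_inj_to_nat_seg[OF finite_verts] by blast
  have "proper_colouring G f"
    using f(2) no_loops unfolding proper_colouring_def arcs_ends_def arc_to_ends_def
    by (auto dest!: inj_onD)
  with f(1) have "colourable G n"
    unfolding colourable_def by auto
  then show ?thesis
    unfolding chromatic_number_def by (rule LeastI)
qed

lemma path_chromatic_numbers_finite_nonempty:
  assumes "graph G" and "verts G \<noteq> {}"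
  shows "finite {chromatic_number (G \<restriction> set p) | p. vpath p G}"
    and "{chromatic_number (G \<restriction> set p) | p. vpath p G} \<noteq> {}"
proof -
  interpret graph G by fact
  have "{chromatic_number (G \<restriction> set p) | p. vpath p G}
      \<subseteq> (\<lambda>S. chromatic_number (G \<restriction> S)) ` Pow (verts G)"
    by (auto simp: vpath_def vwalk_def)
  then show "finite {chromatic_number (G \<restriction> set p) | p. vpath p G}"
    by (rule finite_subset) simp
  from assms(2) obtain v where "v \<in> verts G" by blast
  then have "vpath [v] G" by (auto simp: vpath_def vwalk_def)
  then show "{chromatic_number (G \<restriction> set p) | p. vpath p G} \<noteq> {}" by blast
qed

end

theory Submission
  imports Defs "HOL-Library.FuncSet" "HOL-Real_Asymp.Real_Asymp"
begin

text \<open>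
  The graph consists of a core and of many gadgets attached to it. The core is the complete
  \<open>K\<close>-partite graph with parts $A_0, \dots, A_{K-1}$ of size \<open>s\<close>. For every
  choice of injections $f_i : \{0, \dots, r-1\} \to A_i$ ($i < K$) there is a gadget: a copy of the
  complete graph $K_r$ whose vertex \<open>h\<close> is joined to $f_0(h), \dots, f_{K-1}(h)$.
  Different gadgets are not adjacent.

  The whole graph needs at least $r + K$ colours. If \<open>s\<close> is large, a colouring with fewer
  colours is constant on an \<open>r\<close>-subset of each $A_i$. These \<open>K\<close> colours are
  different, and the gadget attached to just these subsets can use none of them, although it needs
  \<open>r\<close> further colours (\<open>vertices_not_colourable\<close>).

  A path needs only \<open>r\<close> colours. Between two gadgets it has to pass through the core, so
  it meets at most $Ks + 1$ gadgets (\<open>card_components_visited_le\<close>), a number that is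
  polynomial in \<open>r\<close>, and for that few gadgets the core can be coloured favourably.
  Write $r = 2Kb$ and split the vertices of each gadget into $2K$ blocks of size \<open>b\<close>.
  Colour $A_i$ with the two colours $2i$ and $2i+1$. As a gadget yields only $2K$ blocks, counting
  gives such a colouring of the core in which, for every gadget that is met and every
  $c < 2K$, the neighbours in $A_{\lfloor c/2 \rfloor}$ of block \<open>c\<close> are not monochromatic
  (\<open>few_large_sets_bichromatic\<close>). So colour \<open>c\<close> can be placed on some vertex of
  block \<open>c\<close>, and the other vertices of the gadget take the $r - 2K$ colours that do not
  occur in the core (\<open>colouring_of_few_gadgets\<close>).

  The gap between the two numbers is thus at least \<open>K\<close>.
\<close>

section \<open>Symmetric relations as graphs on the natural numbers\<close>

lemma set_vwalk_arcs_subset_iff_successively: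
  "set (vwalk_arcs p) \<subseteq> R \<longleftrightarrow> successively (\<lambda>x y. (x, y) \<in> R) p"
  by (induction p rule: vwalk_arcs.induct) auto

text \<open>
  This allows the construction to be carried out on a convenient vertex type, with
  adjacency a plain relation and colourings plain functions.
\<close>
lemma nat_graph_of_relation:
  fixes V :: "'a set" and E :: "'a \<Rightarrow> 'a \<Rightarrow> bool" and n r :: nat
  assumes "finite V" "V \<noteq> {}"
    and irrefl: "\<And>u. u \<in> V \<Longrightarrow> \<not> E u u"
    and sym: "\<And>u v. u \<in> V \<Longrightarrow> v \<in> V \<Longrightarrow> E u v \<Longrightarrow> E v u"
    and not_colourable: "\<And>c. c ` V \<subseteq> {..<n} \<Longrightarrow> \<exists>u\<in>V. \<exists>v\<in>V. E u v \<and> c u = c v"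
    and path_colourable: "\<And>p. \<lbrakk>distinct p; set p \<subseteq> V; successively E p\<rbrakk> \<Longrightarrow>
      \<exists>c. c ` set p \<subseteq> {..<r} \<and> (\<forall>u\<in>set p. \<forall>v\<in>set p. E u v \<longrightarrow> c u \<noteq> c v)"
  shows "\<exists>G :: (nat, nat \<times> nat) pre_digraph.
    graph G \<and> n < chromatic_number G \<and> path_chromatic_number G \<le> r"
proof -
  obtain e :: "'a \<Rightarrow> nat" where e: "inj_on e V"
    using finite_imp_inj_to_nat_seg[OF \<open>finite V\<close>] by blast
  define G :: "(nat, nat \<times> nat) pre_digraph" where
    "G = \<lparr>verts = e ` V, arcs = {(e u, e v) | u v. u \<in> V \<and> v \<in> V \<and> E u v}, tail = fst, head = snd\<rparr>"
  have verts: "verts G = e ` V" and tail: "tail G = fst" and head: "head G = snd"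
    and arcs: "arcs G = {(e u, e v) | u v. u \<in> V \<and> v \<in> V \<and> E u v}"
    by (simp_all add: G_def)
  have ends: "arcs_ends G = arcs G"
    by (auto simp: arcs_ends_def arc_to_ends_def tail head)
  have "finite (arcs G)"
    by (rule finite_subset[of _ "e ` V \<times> e ` V"]) (use \<open>finite V\<close> in \<open>auto simp: arcs\<close>)
  have no_loop: "e u \<noteq> e v" if "u \<in> V" "v \<in> V" "E u v" for u v
    using irrefl that inj_onD[OF e] by metis
  have "Relation.sym (arcs G)"
    by (rule symI) (use sym in \<open>auto simp: arcs\<close>)
  then have "graph G"
    using \<open>finite V\<close> \<open>finite (arcs G)\<close>
    by unfold_locales
      (auto simp: verts tail head arc_to_ends_def symmetric_def ends, auto simp: arcs no_loop)
  have "n < chromatic_number G"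
  proof (rule ccontr)
    assume "\<not> n < chromatic_number G"
    moreover obtain c where c: "proper_colouring G c" "c ` verts G \<subseteq> {..<chromatic_number G}"
      using colourable_chromatic_number[OF \<open>graph G\<close>] unfolding colourable_def by blast
    ultimately have "(c \<circ> e) ` V \<subseteq> {..<n}"
      unfolding verts image_comp[symmetric] by (meson lessThan_subset_iff linorder_not_less order_trans)
    from not_colourable[OF this] obtain u v where "u \<in> V" "v \<in> V" "E u v" "c (e u) = c (e v)"
      by auto
    with c(1) show False
      unfolding proper_colouring_def ends arcs by blast
  qed
  moreover have "chromatic_number (G \<restriction> set p) \<le> r" if p: "vpath p G" for p
  proof -
    define d where "d = inv_into V e"
    have d: "d x \<in> V" "e (d x) = x" if "x \<in> e ` V" for x
      using that by (auto simp: d_def inv_into_into f_inv_into_f)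
    have d_e: "d (e u) = u" if "u \<in> V" for u
      using that e by (simp add: d_def)
    have p': "set p \<subseteq> e ` V" "distinct p" "successively (\<lambda>x y. (x, y) \<in> arcs G) p"
      using p by (auto simp: vpath_def vwalk_def verts ends set_vwalk_arcs_subset_iff_successively)
    have "inj_on d (set p)"
      using p'(1) unfolding d_def by (rule inj_on_inv_into)
    then have "distinct (map d p)"
      using p' by (simp add: distinct_map)
    moreover have "set (map d p) \<subseteq> V"
      using d p'(1) by auto
    moreover have "successively E (map d p)"
      unfolding successively_map
      by (rule successively_mono[OF p'(3)]) (auto simp: arcs d_e)
    ultimately obtain c where c: "c ` set (map d p) \<subseteq> {..<r}"
      "\<forall>u\<in>set (map d p). \<forall>v\<in>set (map d p). E u v \<longrightarrow> c u \<noteq> c v"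
      using path_colourable[of "map d p"] by (elim meta_impE exE conjE) auto
    have "proper_colouring (G \<restriction> set p) (c \<circ> d)"
      unfolding proper_colouring_def
    proof (clarify)
      fix x y assume "(x, y) \<in> arcs_ends (G \<restriction> set p)" and eq: "(c \<circ> d) x = (c \<circ> d) y"
      then have xy: "x \<in> set p" "y \<in> set p" "(x, y) \<in> arcs G"
        by (auto simp: arcs_ends_def arc_to_ends_def tail head)
      then have "E (d x) (d y)"
        by (auto simp: arcs d_e)
      with c(2) xy eq show False by simp
    qed
    moreover have "(c \<circ> d) ` verts (G \<restriction> set p) \<subseteq> {..<r}"
      using c(1) by auto
    ultimately have "colourable (G \<restriction> set p) r"
      unfolding colourable_def by blast
    then show ?thesis
      unfolding chromatic_number_def by (rule Least_le)
  qed
  then have "path_chromatic_number G \<le> r"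
    using path_chromatic_numbers_finite_nonempty[OF \<open>graph G\<close>] \<open>V \<noteq> {}\<close>
    unfolding path_chromatic_number_def by (subst Max_le_iff) (auto simp: verts)
  ultimately show ?thesis using \<open>graph G\<close> by blast
qed

section \<open>Paths crossing a separator, and bichromatic set families\<close>

text \<open>
  Here \<open>g\<close> labels the components left after removing \<open>W\<close>. A walk changes
  component only by passing through \<open>W\<close>, so each visit to \<open>W\<close> opens at most one new
  component, and only the initial component is not opened in this way.
\<close>
lemma card_components_visited_le:
  assumes "successively E p"
    and "\<And>x y. x \<in> set p \<Longrightarrow> y \<in> set p \<Longrightarrow> E x y \<Longrightarrow> x \<notin> W \<Longrightarrow> y \<notin> W \<Longrightarrow> g x = g y"
  shows "card (g ` (set p - W)) \<le> length (filter (\<lambda>x. x \<in> W) p) + 1"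
proof -
  \<comment> \<open>A walk that starts in \<open>W\<close> has no initial component; the induction needs this saving.\<close>
  have "card (g ` (set p - W)) \<le>
      length (filter (\<lambda>x. x \<in> W) p) + (if p \<noteq> [] \<and> hd p \<in> W then 0 else 1)"
    using assms
  proof (induction p rule: induct_list012)
    case (3 x y zs)
    have IH: "card (g ` (set (y # zs) - W)) \<le>
        length (filter (\<lambda>x. x \<in> W) (y # zs)) + (if y \<in> W then 0 else 1)"
      using 3 by auto
    consider (core) "x \<in> W" | (leave) "x \<notin> W" "y \<in> W" | (stay) "x \<notin> W" "y \<notin> W" by blast
    then show ?case
    proof cases
      case core
      then have "set (x # y # zs) - W = set (y # zs) - W" by auto
      then have "card (g ` (set (x # y # zs) - W)) = card (g ` (set (y # zs) - W))" by (rule arg_cong)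
      then show ?thesis using IH core by (auto split: if_splits)
    next
      case leave
      have "g ` (set (x # y # zs) - W) = insert (g x) (g ` (set (y # zs) - W))"
        using leave by auto
      then have "card (g ` (set (x # y # zs) - W)) \<le> Suc (card (g ` (set (y # zs) - W)))"
        by (metis card_insert_le_m1 card_insert_if finite_imageI finite_Diff List.finite_set le_SucI order_refl)
      then show ?thesis using IH leave by auto
    next
      case stay
      then have "g x = g y" using 3(3,4) by auto
      then have "g ` (set (x # y # zs) - W) = g ` (set (y # zs) - W)"
        using stay by auto
      then show ?thesis using IH stay by auto
    qed
  next
    case (2 x)
    have "card (g ` ({x} - W)) \<le> card {g x}" by (intro card_mono) auto
    then show ?case by auto
  qed auto
  then show ?thesis by (auto split: if_splits)
qed

text \<open>
  The classical counting argument for property B: a set of size \<open>b\<close> is monochromatic in at most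
  $2 \cdot 2^{|X| - b}$ of the $2^{|X|}$ two-colourings of \<open>X\<close> (identified with the colour
  class \<open>U\<close>), so fewer than $2^{b-1}$ such sets cannot spoil all of them.
\<close>
lemma few_large_sets_bichromatic:
  fixes B :: "'j \<Rightarrow> 'a set"
  assumes "finite X" "finite J"
    and B: "\<And>j. j \<in> J \<Longrightarrow> B j \<subseteq> X" "\<And>j. j \<in> J \<Longrightarrow> card (B j) = b"
    and few: "2 * card J < 2 ^ b"
  shows "\<exists>U. \<forall>j\<in>J. B j \<inter> U \<noteq> {} \<and> \<not> B j \<subseteq> U"
proof (rule ccontr)
  assume "\<nexists>U. \<forall>j\<in>J. B j \<inter> U \<noteq> {} \<and> \<not> B j \<subseteq> U"
  then have cover: "Pow X \<subseteq> (\<Union>j\<in>J. Pow (X - B j) \<union> (\<lambda>D. D \<union> B j) ` Pow (X - B j))"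
  proof (intro subsetI)
    fix U assume "U \<in> Pow X"
    from \<open>\<nexists>U. \<forall>j\<in>J. B j \<inter> U \<noteq> {} \<and> \<not> B j \<subseteq> U\<close>
    obtain j where j: "j \<in> J" "B j \<inter> U = {} \<or> B j \<subseteq> U" by blast
    then show "U \<in> (\<Union>j\<in>J. Pow (X - B j) \<union> (\<lambda>D. D \<union> B j) ` Pow (X - B j))"
    proof (elim disjE)
      assume "B j \<subseteq> U"
      then have "U = (U - B j) \<union> B j" "U - B j \<in> Pow (X - B j)"
        using \<open>U \<in> Pow X\<close> by auto
      with j(1) show ?thesis by blast
    qed (use \<open>U \<in> Pow X\<close> in blast)
  qed
  have bound: "card (Pow (X - B j) \<union> (\<lambda>D. D \<union> B j) ` Pow (X - B j)) \<le> 2 * 2 ^ (card X - b)"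
    if "j \<in> J" for j
  proof -
    have "card (Pow (X - B j)) = 2 ^ (card X - b)"
      using B[OF that] \<open>finite X\<close> by (simp add: card_Pow card_Diff_subset finite_subset[of "B j" X])
    moreover have "card ((\<lambda>D. D \<union> B j) ` Pow (X - B j)) \<le> card (Pow (X - B j))"
      using \<open>finite X\<close> by (intro card_image_le) auto
    ultimately show ?thesis
      using card_Un_le[of "Pow (X - B j)" "(\<lambda>D. D \<union> B j) ` Pow (X - B j)"] by linarith
  qed
  have "2 ^ card X = card (Pow X)" using \<open>finite X\<close> by (simp add: card_Pow)
  also have "\<dots> \<le> card (\<Union>j\<in>J. Pow (X - B j) \<union> (\<lambda>D. D \<union> B j) ` Pow (X - B j))"
    using cover assms(1,2) by (intro card_mono) auto
  also have "\<dots> \<le> (\<Sum>j\<in>J. card (Pow (X - B j) \<union> (\<lambda>D. D \<union> B j) ` Pow (X - B j)))"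
    by (rule card_UN_le[OF \<open>finite J\<close>])
  also have "\<dots> \<le> card J * (2 * 2 ^ (card X - b))"
    using sum_bounded_above[of J, OF bound] by simp
  finally have le: "2 ^ card X \<le> (2 * card J) * 2 ^ (card X - b)" by (simp add: ac_simps)
  then have "J \<noteq> {}" by auto
  then have "b \<le> card X" using B \<open>finite X\<close> by (metis card_mono ex_in_conv)
  have "(2 * card J) * 2 ^ (card X - b) < 2 ^ b * 2 ^ (card X - b)"
    using few by simp
  also have "\<dots> = 2 ^ card X"
    using \<open>b \<le> card X\<close> by (simp flip: power_add)
  finally show False using le by simp
qed

section \<open>The construction\<close>

text \<open>
  \<open>Core i x\<close> is the \<open>x\<close>-th vertex of part \<open>i\<close> of the core. A gadget is identified
  with its tuple \<open>f\<close> of attachment maps, and \<open>h\<close> is a vertex of that gadget.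
\<close>
datatype vertex = Core nat nat | Gadget "nat \<Rightarrow> nat \<Rightarrow> nat" nat

fun adjacent :: "vertex \<Rightarrow> vertex \<Rightarrow> bool" where
  "adjacent (Core i x) (Core j y) \<longleftrightarrow> i \<noteq> j"
| "adjacent (Gadget f h) (Gadget g l) \<longleftrightarrow> f = g \<and> h \<noteq> l"
| "adjacent (Core i x) (Gadget f h) \<longleftrightarrow> x = f i h"
| "adjacent (Gadget f h) (Core i x) \<longleftrightarrow> x = f i h"

text \<open>
  The maps are extensional so that there are only finitely many of them. They are injective so that
  the neighbours of a block in a part of the core are as many as the vertices of the block.
\<close>
definition attachments :: "nat \<Rightarrow> nat \<Rightarrow> nat \<Rightarrow> (nat \<Rightarrow> nat \<Rightarrow> nat) set" where
  "attachments K r s =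
    {f \<in> {..<K} \<rightarrow>\<^sub>E {..<r} \<rightarrow>\<^sub>E {..<s}. \<forall>i<K. inj_on (f i) {..<r}}"

definition core :: "nat \<Rightarrow> nat \<Rightarrow> vertex set" where
  "core K s = (\<lambda>(i, x). Core i x) ` ({..<K} \<times> {..<s})"

text \<open>
  The set \<open>F\<close> of gadgets is a parameter because the subgraph relevant to a path contains only
  the gadgets that the path meets.
\<close>
definition vertices :: "nat \<Rightarrow> nat \<Rightarrow> nat \<Rightarrow> (nat \<Rightarrow> nat \<Rightarrow> nat) set \<Rightarrow> vertex set" where
  "vertices K r s F = core K s \<union> (\<lambda>(f, h). Gadget f h) ` (F \<times> {..<r})"

lemma adjacent_irrefl: "\<not> adjacent u u"
  by (cases u) auto

lemma adjacent_sym: "adjacent u v \<Longrightarrow> adjacent v u"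
  by (cases u; cases v) auto

lemma finite_attachments: "finite (attachments K r s)"
proof -
  have "finite ({..<K} \<rightarrow>\<^sub>E {..<r} \<rightarrow>\<^sub>E {..<s})" by (intro finite_PiE) auto
  then show ?thesis unfolding attachments_def by simp
qed

lemma finite_core: "finite (core K s)"
  by (simp add: core_def)

lemma card_core: "card (core K s) = K * s"
  unfolding core_def by (subst card_image) (auto simp: inj_on_def card_cartesian_product)

lemma finite_vertices: "finite F \<Longrightarrow> finite (vertices K r s F)"
  by (simp add: vertices_def finite_core)

lemma attachment_in_range:
  "f \<in> attachments K r s \<Longrightarrow> i < K \<Longrightarrow> h < r \<Longrightarrow> f i h < s"
  by (fastforce simp: attachments_def PiE_iff)

lemma Core_in_vertices [simp]: "Core i x \<in> vertices K r s F \<longleftrightarrow> i < K \<and> x < s"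
  by (auto simp: vertices_def core_def)

lemma Gadget_in_vertices [simp]:
  "Gadget f h \<in> vertices K r s F \<longleftrightarrow> f \<in> F \<and> h < r"
  by (auto simp: vertices_def core_def)

section \<open>Colouring the whole graph\<close>

lemma monochromatic_injection:
  fixes c :: "nat \<Rightarrow> nat"
  assumes "c ` {..<s} \<subseteq> {..<n}" "n * r < s"
  shows "\<exists>g a. g \<in> {..<r} \<rightarrow>\<^sub>E {..<s} \<and> inj_on g {..<r} \<and> a < n \<and> (\<forall>h<r. c (g h) = a)"
proof -
  have "n \<noteq> 0" using assms by (cases n) auto
  then obtain a where a: "a < n" "card (c -` {a} \<inter> {..<s}) * n \<ge> s"
    using pigeonhole_card[of c "{..<s}" "{..<n}"] assms(1) by auto
  have "r \<le> card (c -` {a} \<inter> {..<s})"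
  proof (rule ccontr)
    assume "\<not> ?thesis"
    then have "card (c -` {a} \<inter> {..<s}) * n \<le> r * n" by simp
    with a(2) assms(2) show False by (simp only: mult.commute[of n r] flip: not_less)
  qed
  then obtain g where g: "g ` {..<r} \<subseteq> c -` {a} \<inter> {..<s}" "inj_on g {..<r}"
    using card_le_inj[of "{..<r}" "c -` {a} \<inter> {..<s}"] by auto
  have "restrict g {..<r} \<in> {..<r} \<rightarrow>\<^sub>E {..<s}" using g(1) by auto
  moreover have "inj_on (restrict g {..<r}) {..<r}" using g(2) by (simp add: inj_on_def)
  moreover have "\<forall>h<r. c (restrict g {..<r} h) = a" using g(1) by auto
  ultimately show ?thesis using a(1) by blast
qed

text \<open>
  In each part of the core some \<open>r\<close> vertices share a colour. The gadget attached to these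
  monochromatic sets is, as far as this colouring is concerned, completely joined to a $K_K$, which
  gives a clique on $r + K$ vertices.
\<close>
lemma vertices_not_colourable:
  assumes "c ` vertices K r s (attachments K r s) \<subseteq> {..<n}" "n < r + K" "n * r < s" "0 < r"
  shows "\<exists>u\<in>vertices K r s (attachments K r s).
    \<exists>v\<in>vertices K r s (attachments K r s). adjacent u v \<and> c u = c v"
proof (rule ccontr)
  assume "\<not> ?thesis"
  then have proper: "\<And>u v. \<lbrakk>u \<in> vertices K r s (attachments K r s);
      v \<in> vertices K r s (attachments K r s); adjacent u v\<rbrakk> \<Longrightarrow> c u \<noteq> c v"
    by blast
  have "\<exists>g a. g \<in> {..<r} \<rightarrow>\<^sub>E {..<s} \<and> inj_on g {..<r} \<and> a < n \<and> (\<forall>h<r. c (Core i (g h)) = a)"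
    if "i < K" for i
    by (rule monochromatic_injection[of "\<lambda>x. c (Core i x)"])
      (use assms(3) that in \<open>auto intro!: subsetD[OF assms(1), unfolded lessThan_iff]\<close>)
  then obtain g a where g: "\<And>i. i < K \<Longrightarrow> g i \<in> {..<r} \<rightarrow>\<^sub>E {..<s}"
      "\<And>i. i < K \<Longrightarrow> inj_on (g i) {..<r}"
    and a: "\<And>i. i < K \<Longrightarrow> a i < n" "\<And>i h. i < K \<Longrightarrow> h < r \<Longrightarrow> c (Core i (g i h)) = a i"
    by metis
  define f where "f = restrict g {..<K}"
  have f: "f \<in> attachments K r s"
    using g by (auto simp: f_def attachments_def)
  have a': "c (Core i (f i h)) = a i" if "i < K" "h < r" for i h
    using a that by (simp add: f_def)
  have in_V: "Core i (f i h) \<in> vertices K r s (attachments K r s)" if "i < K" "h < r" for i h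
    using that attachment_in_range[OF f] by simp
  define L where "L = a ` {..<K} \<union> (\<lambda>h. c (Gadget f h)) ` {..<r}"
  have "inj_on a {..<K}"
  proof (rule inj_onI, rule ccontr)
    fix i j assume "i \<in> {..<K}" "j \<in> {..<K}" "a i = a j" "i \<noteq> j"
    then show False
      using proper[of "Core i (f i 0)" "Core j (f j 0)"] assms(4) a' in_V by simp
  qed
  then have "card (a ` {..<K}) = K" by (simp add: card_image)
  moreover have "inj_on (\<lambda>h. c (Gadget f h)) {..<r}"
  proof (rule inj_onI, rule ccontr)
    fix h l assume "h \<in> {..<r}" "l \<in> {..<r}" "c (Gadget f h) = c (Gadget f l)" "h \<noteq> l"
    then show False using proper[of "Gadget f h" "Gadget f l"] f by simp
  qed
  then have "card ((\<lambda>h. c (Gadget f h)) ` {..<r}) = r" by (simp add: card_image)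
  moreover have "a ` {..<K} \<inter> (\<lambda>h. c (Gadget f h)) ` {..<r} = {}"
  proof -
    have "a i \<noteq> c (Gadget f h)" if "i < K" "h < r" for i h
      using proper[of "Core i (f i h)" "Gadget f h"] a' in_V that f by simp
    then show ?thesis by auto
  qed
  ultimately have "card L = K + r"
    unfolding L_def by (subst card_Un_disjoint) auto
  moreover have "L \<subseteq> {..<n}"
    using a(1) subsetD[OF assms(1) imageI] f by (auto simp: L_def)
  then have "card L \<le> n" using card_mono[of "{..<n}" L] by simp
  ultimately show False using assms(2) by simp
qed

section \<open>Colouring a path\<close>

text \<open>
  A bijective colouring of a clique with $mb$ vertices in which only the first \<open>m\<close> colours are
  restricted, colour \<open>c\<close> being allowed somewhere in block \<open>c\<close>. As the blocks are
  disjoint, the vertices receiving these colours can be chosen independently of each other.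
\<close>
lemma bijective_colouring_of_blocks:
  fixes b m :: nat and ok :: "nat \<Rightarrow> nat \<Rightarrow> bool"
  assumes "\<And>c. c < m \<Longrightarrow> \<exists>h\<in>{c * b..<(c + 1) * b}. ok c h"
  shows "\<exists>\<sigma>. inj_on \<sigma> {..<m * b} \<and> \<sigma> ` {..<m * b} \<subseteq> {..<m * b} \<and>
    (\<forall>h<m * b. \<sigma> h < m \<longrightarrow> ok (\<sigma> h) h)"
proof -
  obtain t where t: "\<And>c. c < m \<Longrightarrow> t c \<in> {c * b..<(c + 1) * b}" "\<And>c. c < m \<Longrightarrow> ok c (t c)"
    using assms by metis
  have div: "t c div b = c" if "c < m" for c
    using t(1)[OF that] by (intro div_nat_eqI) (auto simp: algebra_simps)
  have inj: "inj_on t {..<m}" using div by (metis inj_onI lessThan_iff)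
  have less: "t c < m * b" if "c < m" for c
  proof -
    have "t c < (c + 1) * b" using t(1)[OF that] by simp
    also have "\<dots> \<le> m * b" using that by (intro mult_right_mono) auto
    finally show ?thesis .
  qed
  \<comment> \<open>On \<open>T\<close> the colour is the index of the block; elsewhere it is at least \<open>m\<close>.\<close>
  define T where "T = t ` {..<m}"
  have "T \<subseteq> {..<m * b}" using less by (auto simp: T_def)
  have "card ({..<m * b} - T) = m * b - m"
    using \<open>T \<subseteq> {..<m * b}\<close> inj by (subst card_Diff_subset) (auto simp: T_def card_image)
  then obtain \<tau> where \<tau>: "bij_betw \<tau> ({..<m * b} - T) {m..<m * b}"
    using finite_same_card_bij[of "{..<m * b} - T" "{m..<m * b}"] by auto
  define \<sigma> where "\<sigma> h = (if h \<in> T then h div b else \<tau> h)" for h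
  have in_T: "\<sigma> h < m \<and> t (\<sigma> h) = h" if "h \<in> T" for h
    using that div by (auto simp: \<sigma>_def T_def)
  have notin_T: "\<sigma> h \<in> {m..<m * b}" if "h \<in> {..<m * b} - T" for h
    using that bij_betw_apply[OF \<tau>, of h] by (auto simp: \<sigma>_def)
  have "inj_on \<sigma> {..<m * b}"
  proof (rule inj_onI)
    fix h l assume hl: "h \<in> {..<m * b}" "l \<in> {..<m * b}" "\<sigma> h = \<sigma> l"
    consider "h \<in> T" "l \<in> T" | "h \<in> T" "l \<notin> T" | "h \<notin> T" "l \<in> T" | "h \<notin> T" "l \<notin> T" by blast
    then show "h = l"
    proof cases
      case 1 then show ?thesis using in_T hl(3) by metis
    next
      case 2 then show ?thesis using in_T[of h] notin_T[of l] hl by auto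
    next
      case 3 then show ?thesis using in_T[of l] notin_T[of h] hl by auto
    next
      case 4 then show ?thesis
        using hl bij_betw_imp_inj_on[OF \<tau>] by (auto simp: \<sigma>_def dest: inj_onD)
    qed
  qed
  moreover have "\<sigma> h < m * b" if "h < m * b" for h
  proof (cases "h \<in> T")
    case True
    then have "h div b \<le> h" "\<sigma> h = h div b" by (auto simp: \<sigma>_def)
    then show ?thesis using that by linarith
  qed (use notin_T that in auto)
  moreover have "ok (\<sigma> h) h" if "h < m * b" "\<sigma> h < m" for h
  proof (cases "h \<in> T")
    case True
    then show ?thesis using in_T[of h] t(2)[of "\<sigma> h"] by simp
  qed (use notin_T[of h] that in auto)
  ultimately show ?thesis by (intro exI[of _ \<sigma>]) auto
qed

text \<open>
  Each part of the core has its own two colours, so a vertex of a gadget can be given colour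
  \<open>c\<close> as soon as its neighbour in part \<open>c div 2\<close> has the other colour of that part.
  Such a vertex exists in block \<open>c\<close> when the neighbours of the block in part
  \<open>c div 2\<close> are bichromatic. With few gadgets this can be achieved for all
  blocks at once.
\<close>
lemma colouring_of_few_gadgets:
  assumes r: "r = 2 * K * b" and few: "4 * K * card F < 2 ^ b" and "0 < b"
    and F: "F \<subseteq> attachments K r s"
  shows "\<exists>c. c ` vertices K r s F \<subseteq> {..<r} \<and>
    (\<forall>u\<in>vertices K r s F. \<forall>v\<in>vertices K r s F. adjacent u v \<longrightarrow> c u \<noteq> c v)"
proof -
  have "finite F" using F finite_attachments by (rule finite_subset)
  define B where "B = (\<lambda>(f :: nat \<Rightarrow> nat \<Rightarrow> nat, c).
    (\<lambda>h. (c div 2, f (c div 2) h)) ` {c * b..<(c + 1) * b})"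
  have block: "{c * b..<(c + 1) * b} \<subseteq> {..<r}" if "c < 2 * K" for c
  proof -
    have "(c + 1) * b \<le> r" using that unfolding r by (intro mult_right_mono) auto
    then show ?thesis by auto
  qed
  have "\<exists>U. \<forall>j\<in>F \<times> {..<2 * K}. B j \<inter> U \<noteq> {} \<and> \<not> B j \<subseteq> U"
  proof (rule few_large_sets_bichromatic)
    show "finite ({..<K} \<times> {..<s})" "finite (F \<times> {..<2 * K})"
      using \<open>finite F\<close> by auto
    show "2 * card (F \<times> {..<2 * K}) < 2 ^ b"
      using few by (simp add: card_cartesian_product ac_simps)
  next
    fix j assume "j \<in> F \<times> {..<2 * K}"
    then obtain f c where j: "j = (f, c)" "f \<in> attachments K r s" "c < 2 * K" using F by auto
    then have "c div 2 < K" by auto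
    show "B j \<subseteq> {..<K} \<times> {..<s}"
      using block[OF j(3)] attachment_in_range[OF j(2) \<open>c div 2 < K\<close>] \<open>c div 2 < K\<close>
      by (auto simp: B_def j(1))
    have "inj_on (f (c div 2)) {c * b..<(c + 1) * b}"
      using j(2) \<open>c div 2 < K\<close> block[OF j(3)] by (auto simp: attachments_def intro: inj_on_subset)
    then show "card (B j) = b"
      unfolding B_def j(1) by (auto simp: card_image inj_on_def)
  qed
  then obtain U where U: "\<And>f c. f \<in> F \<Longrightarrow> c < 2 * K \<Longrightarrow> B (f, c) \<inter> U \<noteq> {} \<and> \<not> B (f, c) \<subseteq> U"
    by auto
  define col where "col i x = 2 * i + (if (i, x) \<in> U then 1 else 0)" for i x :: nat
  have "\<exists>\<sigma>. inj_on \<sigma> {..<r} \<and> \<sigma> ` {..<r} \<subseteq> {..<r} \<and>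
      (\<forall>h<r. \<sigma> h < 2 * K \<longrightarrow> col (\<sigma> h div 2) (f (\<sigma> h div 2) h) \<noteq> \<sigma> h)" if "f \<in> F" for f
    unfolding r
  proof (rule bijective_colouring_of_blocks)
    fix c assume "c < 2 * K"
    from U[OF that this] obtain h l where
      h: "h \<in> {c * b..<(c + 1) * b}" "(c div 2, f (c div 2) h) \<in> U" and
      l: "l \<in> {c * b..<(c + 1) * b}" "(c div 2, f (c div 2) l) \<notin> U"
      by (fastforce simp only: B_def prod.case)
    show "\<exists>h\<in>{c * b..<(c + 1) * b}. col (c div 2) (f (c div 2) h) \<noteq> c"
    proof (cases "even c")
      case True
      with h show ?thesis by (intro bexI[of _ h]) (auto simp: col_def)
    next
      case False
      then have "2 * (c div 2) \<noteq> c" by presburger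
      with l show ?thesis by (intro bexI[of _ l]) (auto simp: col_def)
    qed
  qed
  then obtain \<sigma> where \<sigma>: "\<And>f. f \<in> F \<Longrightarrow> inj_on (\<sigma> f) {..<r}"
      "\<And>f h. f \<in> F \<Longrightarrow> h < r \<Longrightarrow> \<sigma> f h < r"
      "\<And>f h. f \<in> F \<Longrightarrow> h < r \<Longrightarrow> \<sigma> f h < 2 * K \<Longrightarrow>
        col (\<sigma> f h div 2) (f (\<sigma> f h div 2) h) \<noteq> \<sigma> f h"
    by (metis image_subset_iff lessThan_iff)
  have col_div: "col i x div 2 = i" for i x by (simp add: col_def)
  have col_less: "col i x < 2 * K" if "i < K" for i x using that by (auto simp: col_def)
  have "2 * K \<le> r" using r \<open>0 < b\<close> by simp
  have avoid: "\<sigma> f h \<noteq> col i (f i h)" if "f \<in> F" "h < r" "i < K" for f h i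
    using \<sigma>(3)[OF that(1,2)] col_less[OF that(3)] col_div by metis
  define c where "c v = (case v of Core i x \<Rightarrow> col i x | Gadget f h \<Rightarrow> \<sigma> f h)" for v
  have less: "c u < r" if "u \<in> vertices K r s F" for u
  proof (cases u)
    case (Core i x)
    then show ?thesis using that col_less[of i x] \<open>2 * K \<le> r\<close> by (simp add: c_def)
  next
    case (Gadget f h)
    then show ?thesis using that \<sigma>(2) by (simp add: c_def)
  qed
  have proper: "c u \<noteq> c v" if "u \<in> vertices K r s F" "v \<in> vertices K r s F" "adjacent u v" for u v
  proof (cases u; cases v)
    fix i x j y assume "u = Core i x" "v = Core j y"
    with that show ?thesis using col_div by (metis adjacent.simps(1) c_def vertex.case(1))
  next
    fix i x f h assume "u = Core i x" "v = Gadget f h"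
    with that show ?thesis using avoid[of f h i] by (auto simp: c_def)
  next
    fix i x f h assume "v = Core i x" "u = Gadget f h"
    with that show ?thesis using avoid[of f h i] by (auto simp: c_def)
  next
    fix f h g l assume "u = Gadget f h" "v = Gadget g l"
    with that show ?thesis using \<sigma>(1)[of f] by (auto simp: c_def dest: inj_onD)
  qed
  show ?thesis using less proper by (intro exI[of _ c]) blast
qed

lemma path_vertices_colourable:
  assumes r: "r = 2 * K * b" and b: "4 * K * (K * s + 1) < 2 ^ b" "0 < b"
    and p: "distinct p" "set p \<subseteq> vertices K r s (attachments K r s)" "successively adjacent p"
  shows "\<exists>c. c ` set p \<subseteq> {..<r} \<and> (\<forall>u\<in>set p. \<forall>v\<in>set p. adjacent u v \<longrightarrow> c u \<noteq> c v)"
proof -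
  \<comment> \<open>The value on the core is a dummy: only vertices outside the core are classified.\<close>
  define gadget where "gadget v = (case v of Gadget f h \<Rightarrow> f | Core i x \<Rightarrow> (\<lambda>_ _. 0))" for v
  define F where "F = gadget ` (set p - core K s)"
  have not_core: "\<exists>f h. v = Gadget f h \<and> f \<in> attachments K r s \<and> h < r"
    if "v \<in> set p - core K s" for v
    using that p(2) by (auto simp: vertices_def)
  have "card F \<le> length (filter (\<lambda>v. v \<in> core K s) p) + 1"
    unfolding F_def
  proof (rule card_components_visited_le[OF p(3)])
    fix u v assume "u \<in> set p" "v \<in> set p" "adjacent u v" "u \<notin> core K s" "v \<notin> core K s"
    then show "gadget u = gadget v"
      using not_core[of u] not_core[of v] by (auto simp: gadget_def)
  qed
  also have "length (filter (\<lambda>v. v \<in> core K s) p) = card (set p \<inter> core K s)"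
    using p(1) by (simp flip: distinct_card add: distinct_filter Int_def)
  also have "\<dots> \<le> K * s"
    using card_mono[of "core K s" "set p \<inter> core K s"] finite_core card_core by simp
  finally have "4 * K * card F \<le> 4 * K * (K * s + 1)" by (rule mult_left_mono) simp_all
  then have "4 * K * card F < 2 ^ b" using b(1) by linarith
  moreover have "F \<subseteq> attachments K r s"
    using not_core by (fastforce simp: F_def gadget_def)
  ultimately obtain c where c: "c ` vertices K r s F \<subseteq> {..<r}"
      "\<forall>u\<in>vertices K r s F. \<forall>v\<in>vertices K r s F. adjacent u v \<longrightarrow> c u \<noteq> c v"
    using colouring_of_few_gadgets[OF r _ b(2)] by blast
  have "set p \<subseteq> vertices K r s F"
  proof
    fix v assume v: "v \<in> set p"
    show "v \<in> vertices K r s F"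
    proof (cases "v \<in> core K s")
      case False
      with v obtain f h where "v = Gadget f h" "h < r" using not_core by blast
      moreover have "gadget v \<in> F" using v False by (simp add: F_def)
      ultimately show ?thesis by (simp add: gadget_def)
    qed (simp add: vertices_def)
  qed
  then show ?thesis using c by (intro exI[of _ c]) blast
qed

text \<open>
  With $r = 2Kb$ and $s = (r + K) r$, the number of blocks to be made bichromatic is quadratic in
  \<open>b\<close>, whereas the counting bound is exponential in \<open>b\<close>.
\<close>
lemma exists_block_size:
  fixes K :: nat
  assumes "0 < K"
  shows "\<exists>b>0. 4 * K * (K * ((2 * K * b + K) * (2 * K * b)) + 1) < 2 ^ b"
proof -
  have "0 < real K" using assms by simp
  then have "eventually (\<lambda>b :: nat.
      4 * real K * (real K * ((2 * real K * real b + real K) * (2 * real K * real b)) + 1)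
      < 2 ^ b) at_top"
    by real_asymp
  then have "eventually (\<lambda>b :: nat.
      4 * real K * (real K * ((2 * real K * real b + real K) * (2 * real K * real b)) + 1)
      < 2 ^ b \<and> 0 < b) at_top"
    using eventually_gt_at_top[of "0 :: nat"] by (rule eventually_conj)
  then obtain b :: nat where "0 < b" and
    b: "4 * real K * (real K * ((2 * real K * real b + real K) * (2 * real K * real b)) + 1) < 2 ^ b"
    by (auto simp: eventually_at_top_linorder)
  from b have "real (4 * K * (K * ((2 * K * b + K) * (2 * K * b)) + 1)) < real (2 ^ b)"
    by (simp only: of_nat_mult of_nat_add of_nat_numeral of_nat_power of_nat_1)
  then show ?thesis using \<open>0 < b\<close> of_nat_less_iff by blast
qed

theorem corollary1p3:
  fixes k :: real
  shows "\<exists>G :: (nat, nat \<times> nat) pre_digraph.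
    graph G \<and> real (chromatic_number G) - real (path_chromatic_number G) > k"
proof -
  obtain K :: nat where K: "k < real K" "0 < K"
    using reals_Archimedean2[of "max k 0"] by auto
  then obtain b where "0 < b" and b: "4 * K * (K * ((2 * K * b + K) * (2 * K * b)) + 1) < 2 ^ b"
    using exists_block_size by blast
  define r where "r = 2 * K * b"
  define s where "s = (r + K) * r"
  have "0 < r" using K(2) \<open>0 < b\<close> by (simp add: r_def)
  then have s: "(r + K - 1) * r < s" "0 < s"
    using K(2) by (auto simp: s_def)
  have "\<exists>G :: (nat, nat \<times> nat) pre_digraph.
    graph G \<and> r + K - 1 < chromatic_number G \<and> path_chromatic_number G \<le> r"
  proof (rule nat_graph_of_relation[of "vertices K r s (attachments K r s)" adjacent])
    show "vertices K r s (attachments K r s) \<noteq> {}"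
      using K(2) s(2) Core_in_vertices[of 0 0 K r s] by blast
    show "\<exists>u\<in>vertices K r s (attachments K r s).
    \<exists>v\<in>vertices K r s (attachments K r s). adjacent u v \<and> c u = c v"
      if "c ` vertices K r s (attachments K r s) \<subseteq> {..<r + K - 1}" for c
      using vertices_not_colourable[OF that _ s(1) \<open>0 < r\<close>] K(2) by simp
    show "\<exists>c. c ` set p \<subseteq> {..<r} \<and> (\<forall>u\<in>set p. \<forall>v\<in>set p. adjacent u v \<longrightarrow> c u \<noteq> c v)"
      if "distinct p" "set p \<subseteq> vertices K r s (attachments K r s)" "successively adjacent p" for p
      using path_vertices_colourable[OF r_def _ \<open>0 < b\<close> that] b by (simp add: s_def r_def)
  qed (auto simp: finite_vertices finite_attachments adjacent_irrefl adjacent_sym)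
  then obtain G :: "(nat, nat \<times> nat) pre_digraph" where
    "graph G" "r + K - 1 < chromatic_number G" "path_chromatic_number G \<le> r" by blast
  then show ?thesis using K by (intro exI[of _ G]) auto
qed

end
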